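(* Let constants $\gamma_2>\gamma_1>0$ satisfy $c_f(\gamma_1,\gamma_2)=\gamma_2-(\gamma_1+2l_h w_{x,\max})>0$, and let $H_1:\mathcal{D}\times\mathbb{R}^n\to\mathbb{R}$ be the function $$H_1(t,x)=\Phi^{-1}\Big(\Phi(h(t,x))-\tfrac12\,\mathrm{ssq}\big(\dot h_w(t,x)\big)+\delta\Big),\qquad \delta=\tfrac12\gamma_2^2 .$$ Suppose that $H_1$ is a control barrier function on the set $\{x\in\mathbb{R}^n\mid H_1(t,x)\le 0\}$ and that there are constants $\eta_1,\eta_2>0$ with $W(t,x)\in[\eta_1,\eta_2]$ for all $t\in\mathcal{D}$ and all $x$ with $H_1(t,x)\le 0$, where $$W(t,x)=\|\nabla H_1(t,x)g(t,x)\|\,w_{u,\max}+\|\nabla H_1(t,x)\|\,w_{x,\max}.$$ Let $\alpha_w\in\mathcal{K}$ be locally Lipschitz continuous and satisfy $$\alpha_w^{-1}(2)=-\Phi^{-1}\Big(\tfrac12\gamma_2^2+\Phi(0)-\tfrac12\,(2l_h w_{x,\max}+\gamma_1)^2\Big).$$ Let $u(t,x)$ be a control law, piecewise continuous in $t$ and locally Lipschitz continuous in $x$, such that for all $x\in\mathcal{S}_1(t)$, $t\in\mathcal{D}$, $$\partial_t H_1(t,x)+\nabla H_1(t,x)\big(f(t,x)+g(t,x)u(t,x)\big)=\alpha_w(-H_1(t,x))\,W(t,x)-W(t,x).$$ Suppose the initial condition satisfies $x(t_0)\in\mathcal{S}_1(t_0)$. If furthermore $x(t_0)\in\partial_{\epsilon}\mathcal{S}_1(t_0)$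 with $\epsilon=\alpha_w^{-1}(2)$, i.e. $H_1(t_0,x(t_0))\ge-\alpha_w^{-1}(2)$, then (for any allowable disturbances) there exists a finite $t_f\ge t_0$ such that the closed-loop state $x(t_f)$ corresponds to docking at $t_f$, i.e. $h(t_f,x(t_f))=0$ and $\dot h(t_f,x(t_f))\in[\gamma_1,\gamma_2]$.
   Context: System: $\dot x=f(t,x)+g(t,x)(u+w_u)+w_x$, with time $t\in\mathcal{D}=[t_0,t_f]$ (the symbol $t_f$ is used both for the right endpoint of $\mathcal{D}$ and for the docking time), state $x\in\mathbb{R}^n$, control input $u\in\mathcal{U}\subset\mathbb{R}^m$ ($\mathcal{U}$ compact), and $f:\mathcal{D}\times\mathbb{R}^n\to\mathbb{R}^n$, $g:\mathcal{D}\times\mathbb{R}^n\to\mathbb{R}^{n\times m}$ locally Lipschitz continuous. The disturbances $w_u\in\mathbb{R}^m$, $w_x\in\mathbb{R}^n$ are continuous, and are allowable if $\|w_u\|\le w_{u,\max}$ and $\|w_x\|\le w_{x,\max}$ for known constants $w_{u,\max},w_{x,\max}$. Notation: $\|\cdot\|$ is the 2-norm; $\partial_t$ is the time derivative, $\nabla$ the gradient in $x$ (a row vector), and a dot denotes the total derivative along the system, $\dot F=\partial_tF+\nabla F\,\dot x$ (including the actual disturbance). A function $\alpha:\mathbb{R}_{\ge0}\to\mathbb{R}_{\ge0}$ is in class $\mathcal{K}$ if it is strictly increasing and $\alpha(0)=0$. $\mathrm{ssq}(\lambda)=\lambda|\lambda|$. A superscript $-1$ on a function denotes its inverse function. The function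 $h:\mathcal{D}\times\mathbb{R}^n\to\mathbb{R}$ (a metric for distance between a chaser and a target, negative when they are separated and zero when they are in contact) has relative degree 2 with respect to the system (so $\dot h=\dot h(t,x,w_x)$ does not depend on $u,w_u$), and $\|\nabla h\|$ does not vanish. $\dot h_w(t,x)=\max_{\|w_x\|\le w_{x,\max}}\dot h(t,x,w_x)$, and $\ddot h_w$ denotes the total derivative of $\dot h_w$ along the system. The function $\Phi:\mathbb{R}\to\mathbb{R}$ is invertible, monotone decreasing and continuously differentiable, with derivative $\phi$, and satisfies $$\max_{\|w_u\|\le w_{u,\max},\ \|w_x\|\le w_{x,\max}}\ \inf_{u\in\mathcal{U}}\ \ddot h_w(t,x,u,w_u,w_x)\le\phi(h(t,x))\le0$$ for all $(t,x)$ with $h(t,x)\le0$. Control barrier function (CBF): a continuously differentiable $H:\mathcal{D}\times\mathbb{R}^n\to\mathbb{R}$ is a CBF on a (time-varying) set $\mathcal{X}$ if there is a locally Lipschitz $\alpha_0\in\mathcal{K}$ such that for all $t\in\mathcal{D}$, $x\in\mathcal{X}(t)$: $\max_{\|w_u\|\le w_{u,\max},\|w_x\|\le w_{x,\max}}\inf_{u\in\mathcal{U}}\dot H(t,x,u,w_u,w_x)\le\alpha_0(-H(t,x))$. $\mathcal{S}_1(t)=\{x\in\mathbb{R}^n\mid H_1(t,x)\le0\text{ and }h(t,x)\le d\}$ with $d=\Phi^{-1}(\Phi(0)-\delta)\ge0$, and $\partial_\epsilon\mathcal{S}_1(t)=\{x\in\mathcal{S}_1(t)\mid H_1(t,x)\ge-\epsilon\}$.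 $l_h$ is the Lipschitz constant of $h$ in a neighborhood $\mathcal{Y}\subseteq\mathbb{R}^n$ of the set $\{x\in\mathbb{R}^n\mid h(t,x)=0\}$.
   Formalization: Proved with D=[t_0,∞), the closed-loop solution existing on D, and two added hypotheses: h(t_0,x(t_0))≤0, and Y contains all points of ∂_εS_1(t), t∈D, with h(t_0,x(t_0))≤h≤0 (so l_h is valid during the approach); without either added hypothesis the claim fails. *)

theory Defs
  imports "HOL-Analysis.Analysis"
begin

text \<open>
  Fields and scalar functions take the time as a curried first argument, are regarded as functions
  on D x R^n for a closed time interval D, and have no meaning off D; time derivatives are therefore
  taken within D (one-sided at its end points).
\<close>

definition time_deriv :: "real set \<Rightarrow> (real \<Rightarrow> real^'n \<Rightarrow> real) \<Rightarrow> real \<Rightarrow> real^'n \<Rightarrow> real" where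
  "time_deriv D F t z = vector_derivative (\<lambda>s. F s z) (at t within D)"

definition grad :: "(real \<Rightarrow> real^'n \<Rightarrow> real) \<Rightarrow> real \<Rightarrow> real^'n \<Rightarrow> real^'n" where
  "grad F t z = (\<chi> i. frechet_derivative (F t) (at z) (axis i 1))"

definition C1_on :: "real set \<Rightarrow> (real \<Rightarrow> real^'n \<Rightarrow> real) \<Rightarrow> bool" where
  "C1_on D F \<longleftrightarrow>
     (\<lambda>(t, z). F t z) differentiable_on D \<times> UNIV \<and>
     continuous_on (D \<times> UNIV) (\<lambda>(t, z). time_deriv D F t z) \<and>
     continuous_on (D \<times> UNIV) (\<lambda>(t, z). grad F t z)"

definition locally_lipschitz_on :: "'a::metric_space set \<Rightarrow> ('a \<Rightarrow> 'b::metric_space) \<Rightarrow> bool" where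
  "locally_lipschitz_on S F \<longleftrightarrow> (\<forall>p\<in>S. \<exists>e>0. \<exists>L. L-lipschitz_on (cball p e \<inter> S) F)"

definition piecewise_continuous_on :: "real set \<Rightarrow> (real \<Rightarrow> 'a::metric_space) \<Rightarrow> bool" where
  "piecewise_continuous_on D v \<longleftrightarrow>
     (\<forall>a b. finite {t \<in> D \<inter> {a..b}. \<not> continuous (at t within D) v}) \<and>
     (\<forall>t\<in>D. (\<exists>l. (v \<longlongrightarrow> l) (at t within D \<inter> {..<t})) \<and>
            (\<exists>l. (v \<longlongrightarrow> l) (at t within D \<inter> {t<..})))"

text \<open>
  Only the values of a class K function on the nonnegative reals matter. Nonnegativity follows from
  monotonicity and \<open>\<alpha> 0 = 0\<close>; continuity is not part of the notion.
\<close>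

definition class_K :: "(real \<Rightarrow> real) \<Rightarrow> bool" where
  "class_K \<alpha> \<longleftrightarrow> strict_mono_on {0..} \<alpha> \<and> \<alpha> 0 = 0"

definition ssq :: "real \<Rightarrow> real" where
  "ssq a = a * \<bar>a\<bar>"

definition sys_field ::
  "(real \<Rightarrow> real^'n \<Rightarrow> real^'n) \<Rightarrow> (real \<Rightarrow> real^'n \<Rightarrow> real^'m^'n) \<Rightarrow>
   real \<Rightarrow> real^'n \<Rightarrow> real^'m \<Rightarrow> real^'m \<Rightarrow> real^'n \<Rightarrow> real^'n" where
  "sys_field f g t z u wu wx = f t z + g t z *v (u + wu) + wx"

definition total_deriv ::
  "real set \<Rightarrow> (real \<Rightarrow> real^'n \<Rightarrow> real^'n) \<Rightarrow> (real \<Rightarrow> real^'n \<Rightarrow> real^'m^'n) \<Rightarrow>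
   (real \<Rightarrow> real^'n \<Rightarrow> real) \<Rightarrow> real \<Rightarrow> real^'n \<Rightarrow> real^'m \<Rightarrow> real^'m \<Rightarrow> real^'n \<Rightarrow> real" where
  "total_deriv D f g F t z u wu wx = time_deriv D F t z + grad F t z \<bullet> sys_field f g t z u wu wx"

text \<open>
  The total derivative of a function of relative degree two does not depend on the input and the
  input disturbance, so these are set to zero in \<open>hdot\<close>.
\<close>

definition hdot ::
  "real set \<Rightarrow> (real \<Rightarrow> real^'n \<Rightarrow> real^'n) \<Rightarrow> (real \<Rightarrow> real^'n \<Rightarrow> real^'m^'n) \<Rightarrow>
   (real \<Rightarrow> real^'n \<Rightarrow> real) \<Rightarrow> real \<Rightarrow> real^'n \<Rightarrow> real^'n \<Rightarrow> real" where
  "hdot D f g h t z wx = total_deriv D f g h t z 0 0 wx"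

text \<open>The supremum is attained: \<open>hdot\<close> is affine in the disturbance and the ball is compact.\<close>

definition hdot_w ::
  "real set \<Rightarrow> (real \<Rightarrow> real^'n \<Rightarrow> real^'n) \<Rightarrow> (real \<Rightarrow> real^'n \<Rightarrow> real^'m^'n) \<Rightarrow> real \<Rightarrow>
   (real \<Rightarrow> real^'n \<Rightarrow> real) \<Rightarrow> real \<Rightarrow> real^'n \<Rightarrow> real" where
  "hdot_w D f g wx_max h t z = (SUP wx\<in>cball 0 wx_max. hdot D f g h t z wx)"

text \<open>
  Relative degree two: \<open>h\<close> can be differentiated twice along the system, the input does not
  enter the first derivative, and it enters the second one, where its coefficient is the gradient of
  \<open>hdot\<close> times \<open>g\<close>.
\<close>

definition relative_degree_2 ::
  "real set \<Rightarrow> (real \<Rightarrow> real^'n \<Rightarrow> real^'n) \<Rightarrow> (real \<Rightarrow> real^'n \<Rightarrow> real^'m^'n) \<Rightarrow> real \<Rightarrow>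
   (real \<Rightarrow> real^'n \<Rightarrow> real) \<Rightarrow> bool" where
  "relative_degree_2 D f g wx_max h \<longleftrightarrow>
     C1_on D h \<and>
     (\<forall>t\<in>D. \<forall>z. grad h t z v* g t z = 0) \<and>
     (\<forall>wx\<in>cball 0 wx_max. (\<lambda>(t, z). hdot D f g h t z wx) differentiable_on D \<times> UNIV) \<and>
     (\<exists>t\<in>D. \<exists>z. \<exists>wx\<in>cball 0 wx_max. grad (\<lambda>s y. hdot D f g h s y wx) t z v* g t z \<noteq> 0)"

definition worst_case_rate ::
  "real set \<Rightarrow> (real \<Rightarrow> real^'n \<Rightarrow> real^'n) \<Rightarrow> (real \<Rightarrow> real^'n \<Rightarrow> real^'m^'n) \<Rightarrow> (real^'m) set \<Rightarrow>
   real \<Rightarrow> real \<Rightarrow> (real \<Rightarrow> real^'n \<Rightarrow> real) \<Rightarrow> real \<Rightarrow> real^'n \<Rightarrow> real" where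
  "worst_case_rate D f g U wu_max wx_max F t z =
     (SUP (wu, wx)\<in>cball 0 wu_max \<times> cball 0 wx_max. INF u\<in>U. total_deriv D f g F t z u wu wx)"

definition is_CBF ::
  "real set \<Rightarrow> (real \<Rightarrow> real^'n \<Rightarrow> real^'n) \<Rightarrow> (real \<Rightarrow> real^'n \<Rightarrow> real^'m^'n) \<Rightarrow> (real^'m) set \<Rightarrow>
   real \<Rightarrow> real \<Rightarrow> (real \<Rightarrow> real^'n \<Rightarrow> real) \<Rightarrow> (real \<Rightarrow> (real^'n) set) \<Rightarrow> bool" where
  "is_CBF D f g U wu_max wx_max H X \<longleftrightarrow>
     C1_on D H \<and>
     (\<exists>\<alpha>\<^sub>0. class_K \<alpha>\<^sub>0 \<and> locally_lipschitz_on {0..} \<alpha>\<^sub>0 \<and>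
        (\<forall>t\<in>D. \<forall>z\<in>X t. worst_case_rate D f g U wu_max wx_max H t z \<le> \<alpha>\<^sub>0 (- H t z)))"

definition H1_fun ::
  "real set \<Rightarrow> (real \<Rightarrow> real^'n \<Rightarrow> real^'n) \<Rightarrow> (real \<Rightarrow> real^'n \<Rightarrow> real^'m^'n) \<Rightarrow> real \<Rightarrow>
   (real \<Rightarrow> real^'n \<Rightarrow> real) \<Rightarrow> (real \<Rightarrow> real) \<Rightarrow> real \<Rightarrow> real \<Rightarrow> real^'n \<Rightarrow> real" where
  "H1_fun D f g wx_max h \<Phi> \<delta> t z =
     inv \<Phi> (\<Phi> (h t z) - 1/2 * ssq (hdot_w D f g wx_max h t z) + \<delta>)"

definition W_fun ::
  "(real \<Rightarrow> real^'n \<Rightarrow> real^'m^'n) \<Rightarrow> real \<Rightarrow> real \<Rightarrow> (real \<Rightarrow> real^'n \<Rightarrow> real) \<Rightarrow>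
   real \<Rightarrow> real^'n \<Rightarrow> real" where
  "W_fun g wu_max wx_max H t z =
     norm (grad H t z v* g t z) * wu_max + norm (grad H t z) * wx_max"

definition S1_set ::
  "(real \<Rightarrow> real^'n \<Rightarrow> real) \<Rightarrow> (real \<Rightarrow> real^'n \<Rightarrow> real) \<Rightarrow> real \<Rightarrow> real \<Rightarrow> (real^'n) set" where
  "S1_set H h d t = {z. H t z \<le> 0 \<and> h t z \<le> d}"

definition S1_shell ::
  "(real \<Rightarrow> real^'n \<Rightarrow> real) \<Rightarrow> (real \<Rightarrow> real^'n \<Rightarrow> real) \<Rightarrow> real \<Rightarrow> real \<Rightarrow> real \<Rightarrow> (real^'n) set" where
  "S1_shell H h d \<epsilon> t = {z \<in> S1_set H h d t. - \<epsilon> \<le> H t z}"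

text \<open>
  The closed-loop field may jump in time, so the differential equation is required off a set
  of exceptional times that is finite on bounded intervals.
\<close>

definition closed_loop_solution ::
  "real set \<Rightarrow> (real \<Rightarrow> real^'n \<Rightarrow> real^'n) \<Rightarrow> (real \<Rightarrow> real^'n \<Rightarrow> real^'m^'n) \<Rightarrow>
   (real \<Rightarrow> real^'n \<Rightarrow> real^'m) \<Rightarrow> (real \<Rightarrow> real^'m) \<Rightarrow> (real \<Rightarrow> real^'n) \<Rightarrow> (real \<Rightarrow> real^'n) \<Rightarrow> bool" where
  "closed_loop_solution D f g u wu wx x \<longleftrightarrow>
     continuous_on D x \<and>
     (\<exists>J. (\<forall>a b. finite (J \<inter> {a..b})) \<and>
        (\<forall>t\<in>D - J. (x has_vector_derivative sys_field f g t (x t) (u t (x t)) (wu t) (wx t))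
                      (at t within D)))"

end

theory Submission
  imports Defs
begin

text \<open>
  While \<open>h \<le> 0 < d\<close>, the state stays in the shell \<open>- \<epsilon> \<le> H1 \<le> 0\<close>: on the
  boundary \<open>H1 = 0\<close> the controlled derivative of \<open>H1\<close> is at most \<open>\<alpha>w 0 * W = 0\<close> for all
  allowable disturbances, and below \<open>- \<epsilon>\<close> it is at least \<open>(\<alpha>w \<epsilon> - 2) * W = 0\<close>. The
  initial state may lie on \<open>H1 = 0\<close>, and the control law is unspecified where \<open>H1 > 0\<close>, so
  the upper bound needs an invariance theorem of Nagumo type for the locally Lipschitz closed loop.
  In the shell, \<open>H1 \<ge> - \<epsilon>\<close> and \<open>h \<le> 0\<close> give \<open>hdot_w \<ge> 2 * l_h * wx_max + \<gamma>1\<close>; the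
  disturbance changes \<open>hdot\<close> by at most \<open>2 * l_h * wx_max\<close>, so \<open>hdot \<ge> \<gamma>1\<close> and \<open>h\<close> vanishes
  in finite time. There \<open>H1 \<le> 0\<close> gives \<open>hdot \<le> hdot_w \<le> \<gamma>2\<close>.
\<close>

subsection \<open>Invariance under flows\<close>

text \<open>Continuous induction: if \<open>c\<close> were missed, the supremum of the part of
  \<open>A\<close> below \<open>c\<close> would lie in \<open>A\<close> by closedness, and
  \<open>step\<close> would give points of \<open>A\<close> beyond it.\<close>

lemma right_induct_closed:
  fixes A :: "real set"
  assumes "closed A" "a \<in> A"
    and step: "\<And>t. t \<in> A \<Longrightarrow> a \<le> t \<Longrightarrow> t < b \<Longrightarrow> eventually (\<lambda>s. s \<in> A) (at_right t)"
  shows "{a..b} \<subseteq> A"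
proof (rule ccontr)
  assume "\<not> {a..b} \<subseteq> A"
  then obtain c where c: "a \<le> c" "c \<le> b" "c \<notin> A" unfolding subset_iff atLeastAtMost_iff by blast
  define s where "s = Sup (A \<inter> {a..c})"
  have "s \<in> A \<inter> {a..c}"
    unfolding s_def using assms(1,2) c by (intro closed_contains_Sup) auto
  moreover from this have "s < c" using c by (cases "s = c") auto
  ultimately have "eventually (\<lambda>r. r \<in> A) (at_right s)" using step[of s] c by auto
  moreover have "eventually (\<lambda>r. r \<in> {s<..<c}) (at_right s)"
    using \<open>s < c\<close> by (rule eventually_at_right_real)
  ultimately have "eventually (\<lambda>r. r \<in> A \<and> r \<in> {s<..<c}) (at_right s)"
    by (rule eventually_conj)
  then obtain r where r: "r \<in> A" "s < r" "r < c"
    using eventually_happens'[OF trivial_limit_at_right_real]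
    by (metis (no_types, lifting) greaterThanLessThan_iff)
  with \<open>s \<in> A \<inter> {a..c}\<close> have "r \<in> A \<inter> {a..c}" by auto
  then have "r \<le> s"
    unfolding s_def by (intro cSup_upper) auto
  with r show False by simp
qed

text \<open>A mean value inequality that tolerates finitely many bad times, such as jumps of the
  closed-loop field: integrate the derivative and compare with the constant
  \<open>c\<close>.\<close>

lemma increment_ge_of_deriv_ge:
  fixes y :: "real \<Rightarrow> real"
  assumes "finite S" "a \<le> b" "continuous_on {a..b} y"
    and deriv: "\<And>t. t \<in> {a<..<b} - S \<Longrightarrow> \<exists>y'\<ge>c. (y has_real_derivative y') (at t)"
  shows "c * (b - a) \<le> y b - y a"
proof -
  \<comment> \<open>The default \<open>c\<close> at exceptional times and end points makes
    \<open>c \<le> y' t\<close> hold everywhere, as the comparison of integrals asks.\<close>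
  define y' where "y' t = (if t \<in> {a<..<b} - S then SOME v. v \<ge> c \<and> (y has_real_derivative v) (at t) else c)" for t
  have y': "y' t \<ge> c \<and> (y has_real_derivative y' t) (at t)" if "t \<in> {a<..<b} - S" for t
    using someI_ex[OF deriv[OF that]] that unfolding y'_def by (simp only: if_True)
  have "(y' has_integral (y b - y a)) {a..b}"
    using assms(1-3) y'
    by (intro fundamental_theorem_of_calculus_interior_strong[of S])
       (auto simp: has_real_derivative_iff_has_vector_derivative)
  moreover have "((\<lambda>_. c) has_integral (c * (b - a))) {a..b}"
    using has_integral_const_real[of c a b] assms(2) by (simp add: mult.commute)
  moreover have "c \<le> y' t" for t
    using y'[of t] by (cases "t \<in> {a<..<b} - S") (auto simp: y'_def)
  ultimately show ?thesis
    by (blast intro: has_integral_le)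
qed

text \<open>After the last time \<open>s\<close> up to \<open>t\<close> with
  \<open>c \<le> y s\<close> the function lies below the level, where it cannot decrease; so it
  never falls below \<open>y s\<close>.\<close>

lemma stays_above_level:
  fixes y :: "real \<Rightarrow> real"
  assumes "finite S" "continuous_on {a..b} y" "c \<le> y a"
    and deriv: "\<And>t. t \<in> {a<..<b} - S \<Longrightarrow> y t < c \<Longrightarrow> \<exists>y'\<ge>0. (y has_real_derivative y') (at t)"
    and t: "t \<in> {a..b}"
  shows "c \<le> y t"
proof (rule ccontr)
  assume less: "\<not> c \<le> y t"
  define A where "A = {s \<in> {a..t}. c \<le> y s}"
  have cont: "continuous_on {a..t} y" using assms(2) t by (auto intro: continuous_on_subset)
  have "closed A" unfolding A_def
    using continuous_on_closed_Collect_le[OF continuous_on_const cont] by auto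
  define s where "s = Sup A"
  have "s \<in> A"
    unfolding s_def using \<open>closed A\<close> assms(3) t by (intro closed_contains_Sup) (auto simp: A_def)
  have "y r < c" if "s < r" "r \<le> t" for r
  proof (rule ccontr)
    assume "\<not> y r < c"
    then have "r \<le> s" unfolding s_def using that \<open>s \<in> A\<close> by (intro cSup_upper) (auto simp: A_def)
    with that show False by simp
  qed
  then have "0 * (t - s) \<le> y t - y s"
    using \<open>s \<in> A\<close> t cont assms(1)
    by (intro increment_ge_of_deriv_ge[of S] deriv) (auto simp: A_def intro: continuous_on_subset)
  with \<open>s \<in> A\<close> less show False by (auto simp: A_def)
qed

text \<open>
  A point \<open>p\<close> of \<open>S t\<close> with \<open>norm (x t - p) \<le> \<eta> * exp ((L + 1) * (t - T))\<close> can be carried along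
  with \<open>x\<close> for every \<open>\<eta> > 0\<close>; it need not be a nearest point. The set of times at which such a
  point exists is closed, as a projection of a compact set. Condition \<open>start\<close> replaces
  differentiability of \<open>x\<close> at \<open>T\<close>, where the field may jump.
\<close>

lemma flow_invariance:
  fixes x :: "real \<Rightarrow> 'a::euclidean_space" and S :: "real \<Rightarrow> 'a set" and F :: "real \<Rightarrow> 'a \<Rightarrow> 'a"
  assumes "T \<le> b" "r > 0"
    and closed: "closed {(t, z). t \<in> {T..b} \<and> z \<in> S t}"
    and x: "continuous_on {T..b} x" "x T \<in> S T"
    and deriv: "\<And>t. t \<in> {T<..<b} \<Longrightarrow> (x has_vector_derivative F t (x t)) (at_right t)"
    and L: "L \<ge> 0" "\<And>t p. t \<in> {T<..<b} \<Longrightarrow> p \<in> cball (x t) r \<Longrightarrow>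
              norm (F t (x t) - F t p) \<le> L * norm (x t - p)"
    and inward: "\<And>t p c. t \<in> {T<..<b} \<Longrightarrow> p \<in> cball (x t) r \<Longrightarrow> p \<in> S t \<Longrightarrow> c > 0 \<Longrightarrow>
              \<exists>w. norm (F t p - w) \<le> c \<and> eventually (\<lambda>s. p + (s - t) *\<^sub>R w \<in> S s) (at_right t)"
    and start: "\<And>c. c > 0 \<Longrightarrow> \<exists>z. norm (x T - z) < c \<and> eventually (\<lambda>s. z \<in> S s) (at_right T)"
    and t: "t \<in> {T..b}"
  shows "x t \<in> S t"
proof -
  \<comment> \<open>\<open>L\<close> absorbs the Lipschitz growth of the gap; the extra 1 pays for
    two errors of \<open>\<omega> \<eta> s / 2\<close> per unit time, one from replacing
    \<open>F s p\<close> by \<open>w\<close>, one from linearising \<open>x\<close>.\<close>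
  define K where "K = L + 1"
  define \<omega> where "\<omega> \<eta> s = \<eta> * exp (K * (s - T))" for \<eta> s
  define G where "G \<eta> = {(s, p). s \<in> {T..b} \<and> p \<in> S s \<and> norm (x s - p) \<le> \<omega> \<eta> s}" for \<eta>
  have cont_aux: "continuous_on ({T..b} \<times> UNIV) (\<lambda>(s, p). norm (x s - p) - \<omega> \<eta> s)" for \<eta>
    unfolding \<omega>_def case_prod_beta
    by (intro continuous_intros continuous_on_compose2[OF x(1)]) auto
  \<comment> \<open>The bound on \<open>\<omega> \<eta> b\<close> keeps the companion point in
    \<open>cball (x s) r\<close>, where the Lipschitz estimate and \<open>inward\<close>
    apply.\<close>
  have near: "\<exists>p\<in>S t. norm (x t - p) \<le> \<omega> \<eta> t" if \<eta>: "\<eta> > 0" "\<omega> \<eta> b \<le> r" for \<eta>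
  proof -
    have pos: "\<omega> \<eta> s > 0" for s using \<eta> by (simp add: \<omega>_def)
    have mono: "\<omega> \<eta> s \<le> \<omega> \<eta> s'" if "s \<le> s'" for s s'
      using that \<eta> L unfolding \<omega>_def K_def by (intro mult_left_mono) (auto intro!: mult_left_mono)
    define A where "A = fst ` G \<eta>"
    have "G \<eta> = {(s, z). s \<in> {T..b} \<and> z \<in> S s} \<inter>
            {q \<in> {T..b} \<times> UNIV. (case q of (s, p) \<Rightarrow> norm (x s - p) - \<omega> \<eta> s) \<le> 0}"
      by (auto simp: G_def)
    then have "closed (G \<eta>)"
      using closed continuous_on_closed_Collect_le[OF cont_aux continuous_on_const, of \<eta> 0]
      by (auto intro: closed_Times)
    moreover have "bounded (G \<eta>)"
    proof -
      obtain B where B: "\<And>s. s \<in> {T..b} \<Longrightarrow> norm (x s) \<le> B"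
        using compact_imp_bounded[OF compact_continuous_image[OF x(1) compact_Icc]]
        unfolding bounded_iff by blast
      have "G \<eta> \<subseteq> {T..b} \<times> cball 0 (B + \<omega> \<eta> b)"
      proof (clarsimp simp: G_def)
        fix s p assume *: "T \<le> s" "s \<le> b" "norm (x s - p) \<le> \<omega> \<eta> s"
        have "norm p \<le> norm (x s) + norm (x s - p)"
          using norm_triangle_ineq2[of p "x s"] by (simp add: norm_minus_commute)
        then show "norm p \<le> B + \<omega> \<eta> b" using B[of s] mono[of s b] * by simp
      qed
      then show ?thesis by (rule bounded_subset[rotated]) (intro bounded_Times bounded_cball; simp)
    qed
    ultimately have "closed A"
      unfolding A_def
      by (intro compact_imp_closed compact_continuous_image continuous_intros)
         (simp add: compact_eq_bounded_closed)
    have A_iff: "s \<in> A \<longleftrightarrow> s \<in> {T..b} \<and> (\<exists>p\<in>S s. norm (x s - p) \<le> \<omega> \<eta> s)" for s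
      by (force simp: A_def G_def)
    have "T \<in> A" using x(2) \<open>T \<le> b\<close> pos[of T] by (auto simp: A_iff intro!: bexI[of _ "x T"])
    have "{T..b} \<subseteq> A"
    proof (rule right_induct_closed[OF \<open>closed A\<close> \<open>T \<in> A\<close>])
      fix s assume s: "s \<in> A" "T \<le> s" "s < b"
      have in_b: "eventually (\<lambda>s'. s' \<in> {s<..<b}) (at_right s)"
        using s by (intro eventually_at_right_real) auto
      show "eventually (\<lambda>s'. s' \<in> A) (at_right s)"
      \<comment> \<open>At \<open>T\<close> one fixed point \<open>z\<close> from
        \<open>start\<close> serves for all slightly later times: continuity of \<open>x\<close>
        keeps its distance below \<eta>, hence below the growing tolerance.\<close>
      proof (cases "s = T")
        case True
        obtain z where z: "norm (x T - z) < \<eta>" "eventually (\<lambda>s. z \<in> S s) (at_right T)"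
          using start[OF \<eta>(1)] by auto
        have "(x \<longlongrightarrow> x T) (at T within {T..b})"
          using x(1) \<open>T \<le> b\<close> by (auto simp: continuous_on_def)
        then have "(x \<longlongrightarrow> x T) (at_right T)"
          using s True by (simp add: at_within_Icc_at_right)
        then have "((\<lambda>s. norm (x s - z)) \<longlongrightarrow> norm (x T - z)) (at_right T)"
          by (intro tendsto_intros)
        then have "eventually (\<lambda>s. norm (x s - z) < \<eta>) (at_right T)"
          using z(1) by (rule order_tendstoD)
        with z(2) in_b show ?thesis unfolding True
        proof eventually_elim
          case (elim s')
          then show ?case using mono[of T s'] by (auto simp: A_iff \<omega>_def intro!: bexI[of _ z])
        qed
      next
        case False
        with s have s': "s \<in> {T<..<b}" by auto
        obtain p where p: "p \<in> S s" "norm (x s - p) \<le> \<omega> \<eta> s" using s by (auto simp: A_iff)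
        have p_ball: "p \<in> cball (x s) r"
          using p(2) mono[of s b] \<eta>(2) s by (auto simp: dist_norm)
        obtain w where w: "norm (F s p - w) \<le> \<omega> \<eta> s / 2"
            "eventually (\<lambda>s'. p + (s' - s) *\<^sub>R w \<in> S s') (at_right s)"
          using inward[OF s' p_ball p(1), of "\<omega> \<eta> s / 2"] pos[of s] by auto
        have "eventually (\<lambda>s'. norm (x s' - x s - (s' - s) *\<^sub>R F s (x s)) \<le> \<omega> \<eta> s / 2 * (s' - s)) (at_right s)"
        proof -
          have aux: "norm v \<le> e * k" if "norm (v /\<^sub>R norm k) < e" "0 < k" for v :: 'a and e k :: real
            using that by (simp add: field_simps)
          have "eventually (\<lambda>s'. norm ((x s' - x s - (s' - s) *\<^sub>R F s (x s)) /\<^sub>R norm (s' - s)) < \<omega> \<eta> s / 2) (at_right s)"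
            using deriv[OF s'] pos[of s]
            unfolding has_vector_derivative_def has_derivative_within
            by (intro order_tendstoD(2)[where y = 0] tendsto_norm_zero) (auto simp: diff_diff_eq inverse_eq_divide)
          with in_b show ?thesis
          proof eventually_elim
            case (elim s')
            from elim(1) have "0 < s' - s" by simp
            with elim(2) show ?case by (rule aux)
          qed
        qed
        with w(2) in_b show ?thesis
        proof eventually_elim
          case (elim s')
          define q where "q = p + (s' - s) *\<^sub>R w"
          \<comment> \<open>The new gap splits into the old gap, the difference of the field at
            \<open>x s\<close> and \<open>p\<close>, the error of \<open>w\<close>, and the
            remainder of \<open>x\<close>.\<close>
          have "norm (x s' - q) = norm ((x s - p) + (s' - s) *\<^sub>R (F s (x s) - F s p) + (s' - s) *\<^sub>R (F s p - w)
                  + (x s' - x s - (s' - s) *\<^sub>R F s (x s)))"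
            by (simp add: q_def algebra_simps)
          also have "\<dots> \<le> norm (x s - p) + norm ((s' - s) *\<^sub>R (F s (x s) - F s p))
                  + norm ((s' - s) *\<^sub>R (F s p - w)) + norm (x s' - x s - (s' - s) *\<^sub>R F s (x s))"
            by (rule norm_triangle_le[OF add_right_mono[OF norm_triangle_le[OF add_right_mono[OF norm_triangle_ineq]]]])
          also have "\<dots> \<le> \<omega> \<eta> s + (s' - s) * (L * \<omega> \<eta> s) + (s' - s) * (\<omega> \<eta> s / 2) + \<omega> \<eta> s / 2 * (s' - s)"
          proof -
            have "norm (F s (x s) - F s p) \<le> L * norm (x s - p)" by (rule L(2)[OF s' p_ball])
            also have "\<dots> \<le> L * \<omega> \<eta> s" by (rule mult_left_mono[OF p(2) L(1)])
            finally have 1: "norm ((s' - s) *\<^sub>R (F s (x s) - F s p)) \<le> (s' - s) * (L * \<omega> \<eta> s)"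
              unfolding norm_scaleR using elim(2) by (intro mult_mono) auto
            have 2: "norm ((s' - s) *\<^sub>R (F s p - w)) \<le> (s' - s) * (\<omega> \<eta> s / 2)"
              unfolding norm_scaleR using elim(2) w(1) by (intro mult_mono) auto
            show ?thesis by (rule add_mono[OF add_mono[OF add_mono[OF p(2) 1] 2] elim(3)])
          qed
          also have "\<dots> = \<omega> \<eta> s * (1 + K * (s' - s))"
          proof -
            have "a + k * (l * a) + k * (a / 2) + a / 2 * k = a * (1 + (l + 1) * k)" for a k l :: real
              by (simp add: field_simps)
            then show ?thesis unfolding K_def .
          qed
          also have "\<dots> \<le> \<omega> \<eta> s * exp (K * (s' - s))"
            using pos[of s] by (intro mult_left_mono exp_ge_add_one_self) auto
          also have "\<dots> = \<omega> \<eta> s'"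
          proof -
            have "K * (s' - T) = K * (s - T) + K * (s' - s)"
              by (simp add: right_diff_distrib)
            then show ?thesis by (simp only: \<omega>_def exp_add mult.assoc)
          qed
          finally have "norm (x s' - q) \<le> \<omega> \<eta> s'" .
          then show ?case using elim s' unfolding A_iff q_def by auto
        qed
      qed
    qed
    with t show ?thesis by (auto simp: A_iff)
  qed
  \<comment> \<open>Now \<eta> is shrunk. Points of \<open>S t\<close> come arbitrarily near
    \<open>x t\<close>, and closedness of the graph of \<open>S\<close> puts \<open>x t\<close>
    itself in \<open>S t\<close>.\<close>
  have "\<exists>p\<in>S t. norm (x t - p) < e" if "e > 0" for e
  proof -
    define \<eta> where "\<eta> = min (e / 2) r / exp (K * (b - T))"
    have \<eta>: "\<eta> > 0" "\<omega> \<eta> b = min (e / 2) r" using that \<open>r > 0\<close> by (simp_all add: \<eta>_def \<omega>_def)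
    obtain p where p: "p \<in> S t" "norm (x t - p) \<le> \<omega> \<eta> t" using near[of \<eta>] \<eta> by auto
    have "\<omega> \<eta> t \<le> \<omega> \<eta> b"
      using \<eta>(1) t L unfolding \<omega>_def K_def by (intro mult_left_mono) (auto intro!: mult_left_mono)
    with p \<eta> that show ?thesis by (auto intro!: bexI[of _ p])
  qed
  then have "(t, x t) \<in> closure {(t, z). t \<in> {T..b} \<and> z \<in> S t}"
    unfolding closure_approachable using t
    by (fastforce simp: dist_Pair_Pair dist_norm norm_minus_commute)
  then show ?thesis using closed by (auto simp: closure_closed)
qed

subsection \<open>Derivatives along trajectories\<close>

text \<open>\<open>time_deriv\<close> and \<open>grad\<close> are partial derivatives, while joint
  differentiability gives some linear \<open>G\<close>. Restricting \<open>G\<close> to the time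
  axis and to the state space identifies its two components by uniqueness of derivatives.\<close>

lemma C1_on_has_derivative:
  fixes F :: "real \<Rightarrow> real^'n \<Rightarrow> real"
  assumes "C1_on {t0..} F" "t0 \<le> t"
  shows "((\<lambda>(s, z). F s z) has_derivative (\<lambda>(r, v). r * time_deriv {t0..} F t z + grad F t z \<bullet> v))
           (at (t, z) within {t0..} \<times> UNIV)"
proof -
  obtain G where G: "((\<lambda>(s, z). F s z) has_derivative G) (at (t, z) within {t0..} \<times> UNIV)"
    using assms by (auto simp: C1_on_def differentiable_on_def differentiable_def)
  then interpret G: bounded_linear G by (rule has_derivative_bounded_linear)
  have comp: "((\<lambda>s. F (fst (c s)) (snd (c s))) has_derivative (\<lambda>v. G (c' v))) (at a within A)"
    if "(c has_derivative c') (at a within A)" "c a = (t, z)" "c ` A \<subseteq> {t0..} \<times> UNIV"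
    for c c' and a :: "'x::real_normed_vector" and A
    using has_derivative_in_compose[OF that(1) has_derivative_subset[OF G[folded that(2)] that(3)]]
    by (simp add: case_prod_beta)
  have 1: "((\<lambda>s. F s z) has_derivative (\<lambda>r. G (r, 0))) (at t within {t0..})"
    using comp[of "\<lambda>s. (s, z)" "\<lambda>r. (r, 0)" t "{t0..}"] by (force intro!: derivative_eq_intros)
  have "(\<lambda>r. G (r, 0)) = (\<lambda>r. r *\<^sub>R G (1, 0))"
  proof
    show "G (r, 0) = r *\<^sub>R G (1, 0)" for r using G.scaleR[of r "(1, 0)"] by simp
  qed
  with 1 have "((\<lambda>s. F s z) has_vector_derivative G (1, 0)) (at t within {t0..})"
    by (simp only: has_vector_derivative_def)
  \<comment> \<open>\<open>t\<close> is a limit of larger times, even for \<open>t = t0\<close>;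
    this makes the time derivative within \<open>{t0..}\<close> unique.\<close>
  moreover have "at t within {t0..} \<noteq> bot"
    using islimpt_subset[of t "{t..t + 1}" "{t0..}"] assms(2)
    by (simp add: trivial_limit_within islimpt_Icc subset_iff)
  ultimately have time: "time_deriv {t0..} F t z = G (1, 0)"
    unfolding time_deriv_def by (intro vector_derivative_within) 
  have 2: "(F t has_derivative (\<lambda>v. G (0, v))) (at z)"
    using comp[of "\<lambda>y. (t, y)" "\<lambda>v. (0, v)" z UNIV] assms(2) by (force intro!: derivative_eq_intros)
  then have "frechet_derivative (F t) (at z) = (\<lambda>v. G (0, v))"
    by (rule frechet_derivative_at[symmetric])
  then have 3: "grad F t z = (\<chi> i. G (0, axis i 1))" by (simp only: grad_def)
  have 4: "G (0, v) = (\<Sum>i\<in>UNIV. v $ i * G (0, axis i 1))" for v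
    using linear_sum[OF has_derivative_linear[OF 2], of "\<lambda>i. v $ i *\<^sub>R axis i 1" UNIV]
      linear_cmul[OF has_derivative_linear[OF 2]]
    by (simp add: basis_expansion flip: scalar_mult_eq_scaleR)
  have grad: "grad F t z \<bullet> v = G (0, v)" for v
    unfolding 3 4[of v] by (simp add: inner_vec_def mult.commute)
  have "G (r, v) = r * time_deriv {t0..} F t z + grad F t z \<bullet> v" for r v
    using G.add[of "(r, 0)" "(0, v)"] G.scaleR[of r "(1, 0)"] by (simp add: time grad)
  then have "G = (\<lambda>(r, v). r * time_deriv {t0..} F t z + grad F t z \<bullet> v)" by auto
  with G show ?thesis by simp
qed

text \<open>A general \<open>A\<close> covers both right derivatives (\<open>A = {t..}\<close>) and
  derivatives of the trajectory within the whole time domain.\<close>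

lemma C1_on_along_curve:
  fixes F :: "real \<Rightarrow> real^'n \<Rightarrow> real"
  assumes "C1_on {t0..} F" "t0 \<le> t" "A \<subseteq> {t0..}" "(x has_vector_derivative v) (at t within A)"
  shows "((\<lambda>s. F s (x s)) has_real_derivative time_deriv {t0..} F t (x t) + grad F t (x t) \<bullet> v)
           (at t within A)"
proof -
  have 1: "((\<lambda>s. (s, x s)) has_derivative (\<lambda>r. (r, r *\<^sub>R v))) (at t within A)"
    using assms(4) by (auto simp: has_vector_derivative_def intro!: derivative_eq_intros)
  have 2: "(\<lambda>s. (s, x s)) ` A \<subseteq> {t0..} \<times> UNIV" using assms(3) by auto
  have "((\<lambda>s. F s (x s)) has_derivative
      (\<lambda>r. r * time_deriv {t0..} F t (x t) + grad F t (x t) \<bullet> r *\<^sub>R v)) (at t within A)"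
    using has_derivative_in_compose[OF 1 has_derivative_subset[OF C1_on_has_derivative[OF assms(1,2)] 2]]
    by simp
  then show ?thesis
    by (rule has_derivative_imp_has_field_derivative) (simp add: algebra_simps)
qed

lemma C1_on_has_directional_derivative:
  fixes F :: "real \<Rightarrow> real^'n \<Rightarrow> real"
  assumes "C1_on {t0..} F" "t0 \<le> t"
  shows "((\<lambda>k. F t (z + k *\<^sub>R v)) has_real_derivative grad F t z \<bullet> v) (at 0)"
proof -
  have 1: "((\<lambda>k. (t, z + k *\<^sub>R v)) has_derivative (\<lambda>k. (0, k *\<^sub>R v))) (at 0)"
    by (auto intro!: derivative_eq_intros)
  have 2: "range (\<lambda>k. (t, z + k *\<^sub>R v)) \<subseteq> {t0..} \<times> UNIV"
    using assms(2) by (simp add: image_subset_iff)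
  have 3: "((\<lambda>(s, z). F s z) has_derivative (\<lambda>(r, v). r * time_deriv {t0..} F t z + grad F t z \<bullet> v))
      (at (t, z + 0 *\<^sub>R v) within {t0..} \<times> UNIV)"
    using C1_on_has_derivative[OF assms] by simp
  have "((\<lambda>k. F t (z + k *\<^sub>R v)) has_derivative (\<lambda>k. grad F t z \<bullet> k *\<^sub>R v)) (at 0)"
    using has_derivative_in_compose[OF 1 has_derivative_subset[OF 3 2]] by simp
  then show ?thesis
    by (rule has_derivative_imp_has_field_derivative) simp
qed

text \<open>A directional derivative is a limit of difference quotients; these obey the Lipschitz
  bound once the moving point lies in \<open>Y\<close>, which openness ensures for small
  steps.\<close>

lemma grad_le_lipschitz:
  fixes F :: "real \<Rightarrow> real^'n \<Rightarrow> real"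
  assumes "C1_on {t0..} F" "t0 \<le> t" "open Y" "l-lipschitz_on Y (F t)" "z \<in> Y"
  shows "grad F t z \<bullet> v \<le> l * norm v"
proof -
  have "((\<lambda>k. z + k *\<^sub>R v) \<longlongrightarrow> z + 0 *\<^sub>R v) (at_right 0)" by (intro tendsto_intros)
  then have in_Y: "eventually (\<lambda>k. z + k *\<^sub>R v \<in> Y) (at_right 0)"
    using assms(3,5) by (simp add: topological_tendstoD)
  have "((\<lambda>k. (F t (z + k *\<^sub>R v) - F t z) / k) \<longlongrightarrow> grad F t z \<bullet> v) (at_right 0)"
    using has_field_derivative_at_within[OF C1_on_has_directional_derivative[OF assms(1,2)], of z v "{0<..}"]
    by (simp add: has_field_derivative_iff)
  moreover have "eventually (\<lambda>k. (F t (z + k *\<^sub>R v) - F t z) / k \<le> l * norm v) (at_right 0)"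
    using in_Y eventually_at_right_less[of 0]
  proof eventually_elim
    case (elim k)
    then have "\<bar>F t (z + k *\<^sub>R v) - F t z\<bar> \<le> l * (k * norm v)"
      using lipschitz_on_normD[OF assms(4) elim(1) assms(5)] by simp
    with elim show ?case by (simp add: divide_le_eq mult_ac)
  qed
  ultimately show ?thesis
    by (rule tendsto_upperbound) simp
qed

lemma C1_on_imp_continuous_on:
  assumes "C1_on D F" shows "continuous_on (D \<times> UNIV) (\<lambda>(t, z). F t z)"
  using assms unfolding C1_on_def by (blast intro: differentiable_imp_continuous_on)

lemma locally_lipschitz_on_imp_continuous_on:
  assumes "locally_lipschitz_on S F" shows "continuous_on S F"
  unfolding continuous_on_eq_continuous_within
proof
  fix p assume p: "p \<in> S"
  obtain e L where e: "e > 0" and L: "L-lipschitz_on (cball p e \<inter> S) F"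
    using assms p by (auto simp: locally_lipschitz_on_def)
  have "continuous (at p within cball p e \<inter> S) F"
    using lipschitz_on_continuous_within[OF L] e p by simp
  moreover have "at p within cball p e \<inter> S = at p within S"
    using e by (intro at_within_nhd[of _ "ball p e"]) auto
  ultimately show "continuous (at p within S) F" by simp
qed

text \<open>Supplies \<open>inward\<close> of \<open>flow_invariance\<close>. Tilting
  \<open>v\<close> by length \<open>c\<close> against the gradient lowers the rate of
  \<open>H\<close> by \<open>c * norm n\<close>, which makes it strictly negative where
  \<open>H t p = 0\<close>; where \<open>H t p < 0\<close>, continuity suffices.\<close>

lemma inward_direction:
  fixes H :: "real \<Rightarrow> real^'n \<Rightarrow> real"
  assumes "C1_on {t0..} H" "t0 \<le> t" "H t p \<le> 0" "grad H t p \<noteq> 0" "c > 0"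
    and "H t p = 0 \<Longrightarrow> time_deriv {t0..} H t p + grad H t p \<bullet> v \<le> 0"
  shows "\<exists>w. norm (v - w) \<le> c \<and> eventually (\<lambda>s. H s (p + (s - t) *\<^sub>R w) \<le> 0) (at_right t)"
proof -
  define n where "n = grad H t p"
  define w where "w = v - (c / norm n) *\<^sub>R n"
  have n: "n \<noteq> 0" using assms by (simp add: n_def)
  have "((\<lambda>s. p + (s - t) *\<^sub>R w) has_vector_derivative w) (at t within {t..})"
    by (auto intro!: derivative_eq_intros)
  from C1_on_along_curve[OF assms(1,2) _ this] assms(2)
  have deriv: "((\<lambda>s. H s (p + (s - t) *\<^sub>R w)) has_real_derivative time_deriv {t0..} H t p + n \<bullet> w)
      (at t within {t..})"
    by (simp add: n_def)
  have at_right: "at t within {t..} = at_right t"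
    by (rule at_within_Ici_at_right)
  have "eventually (\<lambda>s. H s (p + (s - t) *\<^sub>R w) \<le> 0) (at_right t)"
  proof (cases "H t p = 0")
    case True
    have "n \<bullet> w = n \<bullet> v - c * norm n"
      using n by (simp add: w_def inner_diff_right dot_square_norm power2_eq_square)
    with True n assms(5,6) have "time_deriv {t0..} H t p + n \<bullet> w < 0"
      by (smt (verit) mult_pos_pos n_def zero_less_norm_iff)
    from has_real_derivative_neg_dec_right[OF deriv this]
    obtain e where "e > 0" "\<And>k. 0 < k \<Longrightarrow> k < e \<Longrightarrow> H (t + k) (p + k *\<^sub>R w) < 0"
      using True by force
    then show ?thesis
      unfolding eventually_at_right_field
      by (intro exI[of _ "t + e"]) (auto, smt (verit) add_diff_cancel_left' diff_add_cancel)
  next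
    case False
    have "((\<lambda>s. H s (p + (s - t) *\<^sub>R w)) \<longlongrightarrow> H t p) (at_right t)"
      using DERIV_continuous[OF deriv] at_right by (simp add: continuous_within)
    with False assms(3) have "eventually (\<lambda>s. H s (p + (s - t) *\<^sub>R w) < 0) (at_right t)"
      by (intro order_tendstoD) auto
    then show ?thesis by eventually_elim simp
  qed
  moreover have "norm (v - w) \<le> c" using n assms(5) by (simp add: w_def)
  ultimately show ?thesis by blast
qed

text \<open>Supplies \<open>start\<close> of \<open>flow_invariance\<close>: a small step against
  the gradient makes \<open>H t\<close> strictly negative, and a strict inequality persists for
  slightly later times.\<close>

lemma interior_point_nearby:
  fixes H :: "real \<Rightarrow> real^'n \<Rightarrow> real"
  assumes C1: "C1_on {t0..} H" and t: "t0 \<le> t" and "H t p \<le> 0" "grad H t p \<noteq> 0" "c > 0"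
  shows "\<exists>z. norm (p - z) < c \<and> eventually (\<lambda>s. H s z \<le> 0) (at_right t)"
proof -
  define n where "n = grad H t p"
  have n: "n \<noteq> 0" using assms by (simp add: n_def)
  have "\<exists>z. norm (p - z) < c \<and> H t z < 0"
  proof (cases "H t p = 0")
    case True
    have "((\<lambda>k. H t (p + k *\<^sub>R (- n))) has_real_derivative n \<bullet> (- n)) (at 0)"
      unfolding n_def by (rule C1_on_has_directional_derivative[OF C1 t])
    from DERIV_neg_dec_right[OF this] n
    obtain e where e: "e > 0" "\<And>k. 0 < k \<Longrightarrow> k < e \<Longrightarrow> H t (p + k *\<^sub>R (- n)) < 0"
      using True by force
    \<comment> \<open>The first term keeps \<open>k\<close> below \<open>e\<close>, the second keeps
      the step length \<open>k * norm n\<close> at most \<open>c / 2\<close>.\<close>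
    define k where "k = min (e / 2) (c / (2 * norm n))"
    have "0 < k" "k < e" "k * norm n < c"
      using e(1) n \<open>c > 0\<close> by (auto simp: k_def min_def field_simps)
    then show ?thesis
      using e(2)[of k] by (intro exI[of _ "p + k *\<^sub>R (- n)"]) auto
  qed (use assms in \<open>auto intro!: exI[of _ p]\<close>)
  then obtain z where z: "norm (p - z) < c" "H t z < 0" by blast
  have "((\<lambda>s. z) has_vector_derivative 0) (at t within {t..})" by simp
  from DERIV_continuous[OF C1_on_along_curve[OF C1 t _ this]] t
  have "((\<lambda>s. H s z) \<longlongrightarrow> H t z) (at_right t)"
    by (simp add: continuous_within at_within_Ici_at_right)
  with z(2) have "eventually (\<lambda>s. H s z < 0) (at_right t)" by (intro order_tendstoD) auto
  then have "eventually (\<lambda>s. H s z \<le> 0) (at_right t)" by eventually_elim simp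
  with z(1) show ?thesis by blast
qed

section \<open>Lipschitz estimate for the closed-loop field\<close>

lemma norm_matrix_vector_mult_bound:
  obtains C where "C \<ge> 0" "\<And>(A::real^'m^'n) v. norm (A *v v) \<le> C * norm A * norm v"
proof -
  have "bilinear (\<lambda>(A::real^'m^'n) v. A *v v)"
    unfolding bilinear_def
    by (auto intro!: linearI simp: algebra_simps matrix_vector_mult_add_rdistrib scaleR_matrix_vector_assoc)
  then have "bounded_bilinear (\<lambda>(A::real^'m^'n) v. A *v v)"
    by (simp add: bilinear_conv_bounded_bilinear)
  from bounded_bilinear.nonneg_bounded[OF this] that show ?thesis
    by (metis mult.commute mult.left_commute)
qed

text \<open>The disturbance \<open>wx\<close> cancels, and the input term splits into the variation
  of \<open>g\<close> times the disturbed input plus \<open>g\<close> times the variation of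
  \<open>u\<close>. A bound on that input and a local bound on \<open>g\<close> then give a constant
  uniform in nearby times.\<close>

lemma closed_loop_field_lipschitz:
  fixes f :: "real \<Rightarrow> real^'n \<Rightarrow> real^'n" and g :: "real \<Rightarrow> real^'n \<Rightarrow> real^'m^'n"
  assumes f: "locally_lipschitz_on (D \<times> UNIV) (\<lambda>(t, z). f t z)"
    and g: "locally_lipschitz_on (D \<times> UNIV) (\<lambda>(t, z). g t z)"
    and u: "local_lipschitz D UNIV u" and T: "T \<in> D"
    and bound: "\<And>t z. t \<in> D \<Longrightarrow> norm (u t z + wu t) \<le> B"
  shows "\<exists>r>0. \<exists>L\<ge>0. \<forall>t\<in>D \<inter> cball T r. \<forall>p\<in>cball z r. \<forall>q\<in>cball z r.
     norm (sys_field f g t p (u t p) (wu t) (wx t) - sys_field f g t q (u t q) (wu t) (wx t))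
       \<le> L * norm (p - q)"
proof -
  obtain ef Lf where ef: "ef > 0" and Lf: "Lf-lipschitz_on (cball (T, z) ef \<inter> D \<times> UNIV) (\<lambda>(t, z). f t z)"
    using f T unfolding locally_lipschitz_on_def by blast
  obtain eg Lg where eg: "eg > 0" and Lg: "Lg-lipschitz_on (cball (T, z) eg \<inter> D \<times> UNIV) (\<lambda>(t, z). g t z)"
    using g T unfolding locally_lipschitz_on_def by blast
  obtain eu Lu where eu: "eu > 0" and Lu: "\<And>t. t \<in> cball T eu \<inter> D \<Longrightarrow> Lu-lipschitz_on (cball z eu \<inter> UNIV) (u t)"
    using local_lipschitzE[OF u T UNIV_I] by blast
  obtain C where C: "C \<ge> 0" "\<And>(A::real^'m^'n) v. norm (A *v v) \<le> C * norm A * norm v"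
    using norm_matrix_vector_mult_bound by blast
  define M where "M = norm (g T z) + Lg * eg"
  \<comment> \<open>Halves, since the distance of pairs is at most the sum of the distances in time
    and state, thus up to \<open>2 * r\<close>.\<close>
  define r where "r = min (ef / 2) (min (eg / 2) eu)"
  have r: "r > 0" using ef eg eu by (simp add: r_def)
  have in_ball: "(t, p) \<in> cball (T, z) e" if "t \<in> cball T r" "p \<in> cball z r" "2 * r \<le> e" for t p e
  proof -
    have "dist (T, z) (t, p) \<le> dist T t + dist z p"
      unfolding dist_Pair_Pair by (rule sqrt_sum_squares_le_sum) auto
    with that show ?thesis by auto
  qed
  have nonneg: "Lf \<ge> 0" "Lg \<ge> 0" "Lu \<ge> 0" "B \<ge> 0" "M \<ge> 0"
    using lipschitz_on_nonneg[OF Lf] lipschitz_on_nonneg[OF Lg] lipschitz_on_nonneg[OF Lu, of T]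
      order_trans[OF norm_ge_zero bound[OF T]] T eg eu
    by (auto simp: M_def)
  define L where "L = Lf + C * Lg * B + C * M * Lu"
  have "norm (sys_field f g t p (u t p) (wu t) (wx t) - sys_field f g t q (u t q) (wu t) (wx t))
       \<le> L * norm (p - q)"
    if t: "t \<in> D \<inter> cball T r" and p: "p \<in> cball z r" and q: "q \<in> cball z r" for t p q
  proof -
    have mem: "(t, p) \<in> cball (T, z) ef \<inter> D \<times> UNIV" "(t, q) \<in> cball (T, z) ef \<inter> D \<times> UNIV"
      "(t, p) \<in> cball (T, z) eg \<inter> D \<times> UNIV" "(t, q) \<in> cball (T, z) eg \<inter> D \<times> UNIV"
      using in_ball[of t _ ef] in_ball[of t _ eg] t p q by (auto simp: r_def)
    have f_le: "norm (f t p - f t q) \<le> Lf * norm (p - q)"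
      using lipschitz_on_normD[OF Lf mem(1,2)] by (simp add: norm_Pair)
    have g_le: "norm (g t p - g t q) \<le> Lg * norm (p - q)"
      using lipschitz_on_normD[OF Lg mem(3,4)] by (simp add: norm_Pair)
    have u_le: "norm (u t p - u t q) \<le> Lu * norm (p - q)"
      using lipschitz_on_normD[OF Lu] t p q by (auto simp: r_def)
    have g_bound: "norm (g t q) \<le> M"
    proof -
      have "(T, z) \<in> cball (T, z) eg \<inter> D \<times> UNIV" using T eg by auto
      then have "norm (g t q - g T z) \<le> Lg * norm ((t, q) - (T, z))"
        using lipschitz_on_normD[OF Lg mem(4)] by auto
      also have "\<dots> = Lg * dist (T, z) (t, q)" by (metis dist_norm dist_commute)
      also have "\<dots> \<le> Lg * eg"
        using mem(4) nonneg by (intro mult_left_mono) auto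
      finally show ?thesis
        using norm_triangle_ineq2[of "g t q" "g T z"] by (simp add: M_def)
    qed
    have "norm (sys_field f g t p (u t p) (wu t) (wx t) - sys_field f g t q (u t q) (wu t) (wx t))
      = norm ((f t p - f t q) + (g t p - g t q) *v (u t p + wu t) + g t q *v (u t p - u t q))"
      by (simp add: sys_field_def algebra_simps)
    also have "\<dots> \<le> norm (f t p - f t q) + norm ((g t p - g t q) *v (u t p + wu t))
        + norm (g t q *v (u t p - u t q))"
      by (intro norm_triangle_le add_mono order_refl)
    also have "\<dots> \<le> Lf * norm (p - q) + C * (Lg * norm (p - q)) * B + C * M * (Lu * norm (p - q))"
      using t by (intro add_mono f_le order_trans[OF C(2)] mult_mono g_le u_le g_bound bound)
         (auto intro!: mult_nonneg_nonneg C(1) nonneg)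
    also have "\<dots> = L * norm (p - q)" by (simp add: L_def algebra_simps)
    finally show ?thesis .
  qed
  moreover have "L \<ge> 0" using nonneg C(1) by (simp add: L_def)
  ultimately show ?thesis using r by blast
qed

section \<open>Actual and worst-case rate of \<open>h\<close>\<close>

lemma hdot_le_hdot_w:
  assumes "norm w \<le> b"
  shows "hdot D f g h t z w \<le> hdot_w D f g b h t z"
  unfolding hdot_w_def
proof (rule cSUP_upper)
  show "bdd_above ((\<lambda>w. hdot D f g h t z w) ` cball 0 b)"
    unfolding hdot_def total_deriv_def sys_field_def
    by (intro compact_imp_bounded bounded_imp_bdd_above compact_continuous_image continuous_intros compact_cball)
qed (use assms in simp)

text \<open>Two allowable disturbances differ by at most \<open>2 * b\<close>, and
  \<open>hdot\<close> sees them only through the inner product with the gradient. This is the origin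
  of the margin \<open>2 * l_h * wx_max\<close>.\<close>

lemma hdot_w_le_hdot:
  assumes "norm w \<le> b" and l: "\<And>v. grad h t z \<bullet> v \<le> l * norm v" and "l \<ge> 0"
  shows "hdot_w D f g b h t z \<le> hdot D f g h t z w + 2 * l * b"
  unfolding hdot_w_def
proof (rule cSUP_least)
  have "0 \<le> b" using norm_ge_zero assms(1) by (rule order_trans)
  then show "cball (0::real^'a) b \<noteq> {}" by simp
  fix v :: "real^'a" assume "v \<in> cball 0 b"
  then have "norm (v - w) \<le> 2 * b" using assms(1) norm_triangle_ineq4[of v w] by simp
  then have "l * norm (v - w) \<le> l * (2 * b)" using \<open>l \<ge> 0\<close> by (rule mult_left_mono)
  then show "hdot D f g h t z v \<le> hdot D f g h t z w + 2 * l * b"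
    using l[of "v - w"] by (simp add: hdot_def total_deriv_def sys_field_def algebra_simps)
qed

subsection \<open>Docking\<close>

lemma continuous_on_along_curve:
  assumes "continuous_on (D \<times> UNIV) (\<lambda>(t, z). F t z)" "continuous_on A x" "A \<subseteq> D"
  shows "continuous_on A (\<lambda>t. F t (x t))"
proof -
  have "continuous_on A (\<lambda>t. (t, x t))" using assms(2) by (intro continuous_intros)
  with assms(1) have "continuous_on A (\<lambda>t. case (t, x t) of (t, z) \<Rightarrow> F t z)"
    by (rule continuous_on_compose2) (use assms(3) in auto)
  then show ?thesis by simp
qed

text \<open>The times with \<open>H t (x t) \<le> 0\<close> form a closed set, so it suffices to get
  from each such \<open>T\<close> across a short window \<open>{T..T + e}\<close>, where
  \<open>flow_invariance\<close> applies with local constants.\<close>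

lemma sublevel_invariance:
  fixes f :: "real \<Rightarrow> real^'n \<Rightarrow> real^'n" and g :: "real \<Rightarrow> real^'n \<Rightarrow> real^'m^'n"
    and H h :: "real \<Rightarrow> real^'n \<Rightarrow> real" and x :: "real \<Rightarrow> real^'n"
  assumes f: "locally_lipschitz_on ({t0..} \<times> UNIV) (\<lambda>(t, z). f t z)"
    and g: "locally_lipschitz_on ({t0..} \<times> UNIV) (\<lambda>(t, z). g t z)"
    and u: "local_lipschitz {t0..} UNIV u"
    and bound: "\<And>t z. t0 \<le> t \<Longrightarrow> norm (u t z + wu t) \<le> B"
    and H: "C1_on {t0..} H" and h: "continuous_on ({t0..} \<times> UNIV) (\<lambda>(t, z). h t z)"
    and x: "closed_loop_solution {t0..} f g u wu wx x"
    and grad: "\<And>t z. t0 \<le> t \<Longrightarrow> H t z \<le> 0 \<Longrightarrow> grad H t z \<noteq> 0"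
    and boundary: "\<And>t z. t0 \<le> t \<Longrightarrow> H t z = 0 \<Longrightarrow> h t z \<le> d \<Longrightarrow>
          time_deriv {t0..} H t z + grad H t z \<bullet> sys_field f g t z (u t z) (wu t) (wx t) \<le> 0"
    and init: "H t0 (x t0) \<le> 0" and h_less: "\<And>t. t \<in> {t0..b} \<Longrightarrow> h t (x t) < d"
    and t: "t \<in> {t0..b}"
  shows "H t (x t) \<le> 0"
proof -
  define F where "F t z = sys_field f g t z (u t z) (wu t) (wx t)" for t z
  obtain J where x_cont: "continuous_on {t0..} x" and J: "\<And>a b. finite (J \<inter> {a..b})"
    and deriv: "\<And>t. t \<in> {t0..} - J \<Longrightarrow> (x has_vector_derivative F t (x t)) (at t within {t0..})"
    using x unfolding closed_loop_solution_def F_def by blast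
  have H_cont: "continuous_on ({t0..} \<times> UNIV) (\<lambda>(t, z). H t z)"
    by (rule C1_on_imp_continuous_on[OF H])
  define A where "A = {t \<in> {t0..b}. H t (x t) \<le> 0}"
  have "continuous_on {t0..b} (\<lambda>t. H t (x t))"
    by (rule continuous_on_along_curve[OF H_cont continuous_on_subset[OF x_cont]]) auto
  then have "closed A"
    unfolding A_def by (rule continuous_on_closed_Collect_le[OF _ continuous_on_const]) simp
  moreover have "t0 \<in> A" using init t by (auto simp: A_def)
  ultimately have "{t0..b} \<subseteq> A"
  proof (rule right_induct_closed)
    fix T assume T: "T \<in> A" "t0 \<le> T" "T < b"
    obtain r1 L where r1: "r1 > 0" and L: "L \<ge> 0"
      and lip: "\<And>t p q. t \<in> {t0..} \<inter> cball T r1 \<Longrightarrow> p \<in> cball (x T) r1 \<Longrightarrow> q \<in> cball (x T) r1 \<Longrightarrow>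
         norm (F t p - F t q) \<le> L * norm (p - q)"
      using closed_loop_field_lipschitz[OF f g u _ bound, of T "x T" wx] T(2) unfolding F_def by auto
    \<comment> \<open>\<open>boundary\<close> must be usable at points beside the trajectory, so the
      strict inequality \<open>h T (x T) < d\<close> is extended to a neighbourhood of
      \<open>(T, x T)\<close>.\<close>
    obtain e2 where e2: "e2 > 0"
      and h_near: "\<And>t z. t0 \<le> t \<Longrightarrow> dist (t, z) (T, x T) < e2 \<Longrightarrow> h t z < d"
    proof -
      have "0 < d - h T (x T)" using h_less[of T] T by simp
      moreover have "(T, x T) \<in> {t0..} \<times> UNIV" using T(2) by simp
      ultimately obtain e where e: "e > 0" "\<And>p. p \<in> {t0..} \<times> UNIV \<Longrightarrow> dist p (T, x T) < e \<Longrightarrow>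
          dist (case p of (t, z) \<Rightarrow> h t z) (h T (x T)) < d - h T (x T)"
        using h unfolding continuous_on_iff by (metis (no_types, lifting) case_prod_conv)
      show thesis
      proof (rule that[OF e(1)])
        show "h t z < d" if "t0 \<le> t" "dist (t, z) (T, x T) < e" for t z
          using e(2)[of "(t, z)"] that by (simp add: dist_real_def abs_less_iff)
      qed
    qed
    \<comment> \<open>In the window, points within \<open>r\<close> of \<open>x t\<close> are within
      \<open>2 * r\<close> of \<open>x T\<close>; adding a time distance of at most
      \<open>e \<le> r\<close> stays below \<open>e2\<close>.\<close>
    define r where "r = min (r1 / 2) (e2 / 4)"
    have r: "r > 0" "2 * r \<le> r1" "4 * r \<le> e2" using r1 e2 by (auto simp: r_def)
    obtain e3 where e3: "e3 > 0" and x_near: "\<And>t. t0 \<le> t \<Longrightarrow> dist t T < e3 \<Longrightarrow> dist (x t) (x T) < r"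
      using x_cont T(2) r(1) unfolding continuous_on_iff by (metis atLeast_iff)
    \<comment> \<open>Finitely many jump times lie in \<open>{T..T + 1}\<close>, so a window to the
      right of \<open>T\<close> avoids them; \<open>T\<close> itself may be one, which
      \<open>start\<close> accommodates.\<close>
    have "\<not> T islimpt (J \<inter> {T..T + 1})" using J islimpt_finite by blast
    then obtain e4 where e4: "e4 > 0"
      and no_J: "\<And>t. t \<noteq> T \<Longrightarrow> dist t T < e4 \<Longrightarrow> t \<notin> J \<inter> {T..T + 1}"
      unfolding islimpt_iff_eventually eventually_at by blast
    define e where "e = Min {r1, r, e3 / 2, e4 / 2, 1, b - T}"
    have e: "e > 0" "e \<le> r1" "e \<le> r" "e < e3" "e < e4" "e \<le> 1" "e \<le> b - T"
      using r1 r e3 e4 T unfolding e_def by auto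
    have near: "dist p (x T) < 2 * r" if "t \<in> {T..T + e}" "p \<in> cball (x t) r" for t p
    proof -
      have "dist (x t) (x T) < r" using that e T by (intro x_near) (auto simp: dist_real_def)
      with that dist_triangle[of p "x T" "x t"] show ?thesis by (simp add: dist_commute)
    qed
    have h_le: "h t p \<le> d" if "t \<in> {T..T + e}" "p \<in> cball (x t) r" for t p
    proof -
      have "dist (t, p) (T, x T) \<le> dist t T + dist p (x T)"
        unfolding dist_Pair_Pair by (rule sqrt_sum_squares_le_sum) auto
      also have "\<dots> < e2" using near[OF that] that(1) e r by (auto simp: dist_real_def)
      finally show ?thesis using h_near[of t p] that(1) T by auto
    qed
    have "H t (x t) \<le> 0" if "t \<in> {T..T + e}" for t
    proof -
      have "x t \<in> {z. H t z \<le> 0}"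
      proof (rule flow_invariance[where S = "\<lambda>t. {z. H t z \<le> 0}" and x = x and t = t and T = T and b = "T + e" and r = r and L = L and F = F])
        have "continuous_on ({T..T + e} \<times> UNIV) (\<lambda>q. case q of (t, z) \<Rightarrow> H t z)"
          using T(2) by (intro continuous_on_subset[OF H_cont]) auto
        then have "closed {q \<in> {T..T + e} \<times> UNIV. (case q of (t, z) \<Rightarrow> H t z) \<le> 0}"
          by (rule continuous_on_closed_Collect_le[OF _ continuous_on_const]) (simp add: closed_Times)
        moreover have "{(t, z). t \<in> {T..T + e} \<and> z \<in> {z. H t z \<le> 0}}
            = {q \<in> {T..T + e} \<times> UNIV. (case q of (t, z) \<Rightarrow> H t z) \<le> 0}" by auto
        ultimately show "closed {(t, z). t \<in> {T..T + e} \<and> z \<in> {z. H t z \<le> 0}}" by simp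
        show "continuous_on {T..T + e} x"
          using T(2) by (intro continuous_on_subset[OF x_cont]) auto
        show "x T \<in> {z. H T z \<le> 0}" using T(1) by (simp add: A_def)
        show "(x has_vector_derivative F s (x s)) (at_right s)" if s: "s \<in> {T<..<T + e}" for s
        proof -
          have "s \<notin> J" using no_J[of s] s e by (auto simp: dist_real_def)
          then show ?thesis
            using s T(2) by (intro has_vector_derivative_within_subset[OF deriv]) auto
        qed
        show "norm (F s (x s) - F s p) \<le> L * norm (x s - p)"
          if s: "s \<in> {T<..<T + e}" and p: "p \<in> cball (x s) r" for s p
        proof (rule lip)
          show "s \<in> {t0..} \<inter> cball T r1" using s e T(2) by (auto simp: dist_real_def)
          show "p \<in> cball (x T) r1" using near[of s p] s p r by (auto simp: dist_commute)
          show "x s \<in> cball (x T) r1" using near[of s "x s"] s r by (auto simp: dist_commute)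
        qed
        show "\<exists>w. norm (F s p - w) \<le> c \<and> (\<forall>\<^sub>F s' in at_right s. p + (s' - s) *\<^sub>R w \<in> {z. H s' z \<le> 0})"
          if s: "s \<in> {T<..<T + e}" and p: "p \<in> cball (x s) r" "p \<in> {z. H s z \<le> 0}" and "c > 0" for s p c
          using inward_direction[OF H, of s p c "F s p"] grad[of s p] boundary[of s p] h_le[of s p] s p T(2) \<open>c > 0\<close>
          by (auto simp: F_def)
        show "\<exists>z. norm (x T - z) < c \<and> (\<forall>\<^sub>F s in at_right T. z \<in> {z. H s z \<le> 0})" if "c > 0" for c
          using interior_point_nearby[OF H T(2), of "x T" c] T grad[of T "x T"] that by (simp add: A_def)
      qed (use that e r L in auto)
      then show ?thesis by simp
    qed
    moreover have "eventually (\<lambda>s. s \<in> {T<..<T + e}) (at_right T)"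
      using e by (intro eventually_at_right_real) simp
    ultimately show "eventually (\<lambda>s. s \<in> A) (at_right T)"
      using e T(2) by (auto simp: A_def elim!: eventually_mono)
  qed
  with t show ?thesis by (auto simp: A_def)
qed

theorem corollary1:
  fixes t0 wu_max wx_max \<gamma>1 \<gamma>2 \<eta>1 \<eta>2 l_h \<delta> d \<epsilon> :: real
    and D :: "real set"
    and U :: "(real^'m) set"
    and Y :: "(real^'n) set"
    and f :: "real \<Rightarrow> real^'n \<Rightarrow> real^'n"
    and g :: "real \<Rightarrow> real^'n \<Rightarrow> real^'m^'n"
    and h H1 W :: "real \<Rightarrow> real^'n \<Rightarrow> real"
    and \<Phi> \<phi> \<alpha>w :: "real \<Rightarrow> real"
    and u :: "real \<Rightarrow> real^'n \<Rightarrow> real^'m"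
    and wu :: "real \<Rightarrow> real^'m"
    and wx x :: "real \<Rightarrow> real^'n"
  assumes D: "D = {t0..}"
    and U: "compact U" "U \<noteq> {}"
    and f: "locally_lipschitz_on (D \<times> UNIV) (\<lambda>(t, z). f t z)"
    and g: "locally_lipschitz_on (D \<times> UNIV) (\<lambda>(t, z). g t z)"
    and w_max: "0 \<le> wu_max" "0 \<le> wx_max"
    and h_rel_degree: "relative_degree_2 D f g wx_max h"
    and h_grad: "\<And>t z. t \<in> D \<Longrightarrow> norm (grad h t z) \<noteq> 0"
    and \<Phi>: "bij \<Phi>" "antimono \<Phi>"
    and \<phi>: "\<And>s. (\<Phi> has_real_derivative \<phi> s) (at s)" "continuous_on UNIV \<phi>"
    and \<Phi>_h: "\<And>t z. t \<in> D \<Longrightarrow> h t z \<le> 0 \<Longrightarrow>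
        worst_case_rate D f g U wu_max wx_max (hdot_w D f g wx_max h) t z \<le> \<phi> (h t z) \<and>
        \<phi> (h t z) \<le> 0"
    and Y_nbhd: "open Y" "\<And>t. t \<in> D \<Longrightarrow> {z. h t z = 0} \<subseteq> Y"
    and l_h: "\<And>t. t \<in> D \<Longrightarrow> l_h-lipschitz_on Y (h t)"
    and \<gamma>: "\<gamma>2 > \<gamma>1" "\<gamma>1 > 0"
    and c_f: "\<gamma>2 - (\<gamma>1 + 2 * l_h * wx_max) > 0"
    and \<delta>: "\<delta> = 1/2 * \<gamma>2\<^sup>2"
    and d: "d = inv \<Phi> (\<Phi> 0 - \<delta>)"
    and H1: "H1 = H1_fun D f g wx_max h \<Phi> \<delta>"
    and H1_CBF: "is_CBF D f g U wu_max wx_max H1 (\<lambda>t. {z. H1 t z \<le> 0})"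
    and W: "W = W_fun g wu_max wx_max H1"
    and \<eta>: "\<eta>1 > 0" "\<eta>2 > 0"
    and W_bounds: "\<And>t z. t \<in> D \<Longrightarrow> H1 t z \<le> 0 \<Longrightarrow> W t z \<in> {\<eta>1..\<eta>2}"
    and \<alpha>w: "class_K \<alpha>w" "locally_lipschitz_on {0..} \<alpha>w" "2 \<in> \<alpha>w ` {0..}"
    and \<epsilon>: "\<epsilon> = inv_into {0..} \<alpha>w 2"
    and \<alpha>w_2: "\<epsilon> = - inv \<Phi> (1/2 * \<gamma>2\<^sup>2 + \<Phi> 0 - 1/2 * (2 * l_h * wx_max + \<gamma>1)\<^sup>2)"
    and u_range: "\<And>t z. t \<in> D \<Longrightarrow> u t z \<in> U"
    and u_time: "\<And>z. piecewise_continuous_on D (\<lambda>t. u t z)"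
    and u_state: "local_lipschitz D UNIV u"
    and u_eq: "\<And>t z. t \<in> D \<Longrightarrow> z \<in> S1_set H1 h d t \<Longrightarrow>
        time_deriv D H1 t z + grad H1 t z \<bullet> (f t z + g t z *v u t z)
          = \<alpha>w (- H1 t z) * W t z - W t z"
    and wu: "continuous_on D wu" "\<And>t. t \<in> D \<Longrightarrow> norm (wu t) \<le> wu_max"
    and wx: "continuous_on D wx" "\<And>t. t \<in> D \<Longrightarrow> norm (wx t) \<le> wx_max"
    and x: "closed_loop_solution D f g u wu wx x"
    and x0: "x t0 \<in> S1_set H1 h d t0" "x t0 \<in> S1_shell H1 h d \<epsilon> t0"
    and not_penetrating: "h t0 (x t0) \<le> 0"
    and approach_in_Y: "\<And>t. t \<in> D \<Longrightarrow>
        {z \<in> S1_shell H1 h d \<epsilon> t. h t0 (x t0) \<le> h t z \<and> h t z \<le> 0} \<subseteq> Y"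
  shows "\<exists>tf\<ge>t0. h tf (x tf) = 0 \<and>
           total_deriv D f g h tf (x tf) (u tf (x tf)) (wu tf) (wx tf) \<in> {\<gamma>1..\<gamma>2}"
proof -
  obtain J where x_cont: "continuous_on D x" and J: "\<And>a b. finite (J \<inter> {a..b})"
    and x_deriv: "\<And>t. t \<in> D - J \<Longrightarrow>
       (x has_vector_derivative sys_field f g t (x t) (u t (x t)) (wu t) (wx t)) (at t within D)"
    using x unfolding closed_loop_solution_def by blast
  have h_C1: "C1_on {t0..} h" and h_g: "\<And>t z. t0 \<le> t \<Longrightarrow> grad h t z v* g t z = 0"
    using h_rel_degree by (auto simp: relative_degree_2_def D)
  have H1_C1: "C1_on {t0..} H1" using H1_CBF by (simp add: is_CBF_def D)
  have l_nonneg: "0 \<le> l_h" using lipschitz_on_nonneg[OF l_h[of t0]] by (simp add: D)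
  have total_h: "total_deriv D f g h t z v w w' = hdot D f g h t z w'" if "t0 \<le> t" for t z v w w'
    by (simp add: hdot_def total_deriv_def sys_field_def inner_add_right h_g[OF that] flip: dot_lmul_matrix)

  \<comment> \<open>Values of \<open>H1\<close> and the size of \<open>hdot_w\<close>\<close>
  have \<Phi>_le: "\<Phi> b \<le> \<Phi> a" if "a \<le> b" for a b using \<Phi>(2) that by (auto simp: antimono_def)
  have \<Phi>_inv: "\<Phi> (inv \<Phi> a) = a" for a using \<Phi>(1) by (simp add: bij_is_surj surj_f_inv_f)
  have \<Phi>_H1: "\<Phi> (H1 t z) = \<Phi> (h t z) - 1/2 * ssq (hdot_w D f g wx_max h t z) + \<delta>" for t z
    by (simp add: H1 H1_fun_def \<Phi>_inv)
  \<comment> \<open>Otherwise \<open>\<Phi> 0 \<le> \<Phi> d = \<Phi> 0 - \<delta>\<close>. The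
    strict sign turns \<open>h \<le> 0\<close> into the strict \<open>h < d\<close> required by
    \<open>sublevel_invariance\<close>.\<close>
  have d_pos: "0 < d"
    using \<Phi>_le[of d 0] \<gamma> by (force simp: d \<Phi>_inv \<delta> not_le)

  have upper: "hdot_w D f g wx_max h t z \<le> \<gamma>2" if "H1 t z \<le> 0" "h t z = 0" for t z
  proof (rule ccontr)
    assume *: "\<not> ?thesis"
    then have "\<gamma>2\<^sup>2 < ssq (hdot_w D f g wx_max h t z)"
      using \<gamma> power_strict_mono[of \<gamma>2 "hdot_w D f g wx_max h t z" 2] by (simp add: ssq_def power2_eq_square)
    then show False using \<Phi>_le[OF that(1)] \<Phi>_H1[of t z] that(2) \<delta> by simp
  qed
  \<comment> \<open>\<epsilon> is calibrated so that \<open>\<Phi> (- \<epsilon>) = \<Phi> 0 +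
    \<delta> - 1/2 * a\<^sup>2\<close>. As \<Phi> reverses order, both premises together force
    \<open>ssq\<close> of the worst-case rate to be at least \<open>a\<^sup>2\<close>; the sign kept
    by \<open>ssq\<close> excludes large negative rates.\<close>
  have lower: "2 * l_h * wx_max + \<gamma>1 \<le> hdot_w D f g wx_max h t z" if "- \<epsilon> \<le> H1 t z" "h t z \<le> 0" for t z
  proof (rule ccontr)
    define a where "a = 2 * l_h * wx_max + \<gamma>1"
    have "0 < a" using l_nonneg w_max \<gamma> by (simp add: a_def add_nonneg_pos)
    assume "\<not> ?thesis"
    then have less: "hdot_w D f g wx_max h t z < a" by (simp add: a_def)
    have "ssq (hdot_w D f g wx_max h t z) < a\<^sup>2"
    proof (cases "hdot_w D f g wx_max h t z \<le> 0")
      case True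
      then have "ssq (hdot_w D f g wx_max h t z) \<le> 0" by (simp add: ssq_def mult_le_0_iff)
      also have "\<dots> < a\<^sup>2" using \<open>0 < a\<close> by simp
      finally show ?thesis .
    next
      case False
      then show ?thesis
        using power_strict_mono[OF less, of 2] by (simp add: ssq_def power2_eq_square)
    qed
    moreover have "\<Phi> (- \<epsilon>) = 1/2 * \<gamma>2\<^sup>2 + \<Phi> 0 - 1/2 * a\<^sup>2" by (simp add: \<alpha>w_2 \<Phi>_inv a_def)
    ultimately show False using \<Phi>_le[OF that(1)] \<Phi>_le[OF that(2)] \<Phi>_H1[of t z] \<delta> by simp
  qed

  \<comment> \<open>Rate of \<open>H1\<close> under control and disturbance\<close>
  have \<epsilon>_pos: "0 \<le> \<epsilon>" and \<alpha>w_\<epsilon>: "\<alpha>w \<epsilon> = 2"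
    using inv_into_into[OF \<alpha>w(3)] f_inv_into_f[OF \<alpha>w(3)] by (auto simp: \<epsilon>)
  have disturbance: "\<bar>grad H1 t z \<bullet> (g t z *v wu t) + grad H1 t z \<bullet> wx t\<bar> \<le> W t z" if "t0 \<le> t" for t z
  proof -
    have "\<bar>grad H1 t z \<bullet> (g t z *v wu t)\<bar> \<le> norm (grad H1 t z v* g t z) * wu_max"
      unfolding dot_lmul_matrix[symmetric] using wu(2)[of t] that
      by (intro order_trans[OF Cauchy_Schwarz_ineq2] mult_left_mono) (auto simp: D)
    moreover have "\<bar>grad H1 t z \<bullet> wx t\<bar> \<le> norm (grad H1 t z) * wx_max"
      using wx(2)[of t] that by (intro order_trans[OF Cauchy_Schwarz_ineq2] mult_left_mono) (auto simp: D)
    ultimately show ?thesis unfolding W W_fun_def by linarith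
  qed
  \<comment> \<open>The control law fixes the nominal rate and the disturbance adds
    \<open>w\<close>, so the true rate lies between
    \<open>(\<alpha>w (- H1 t z) - 2) * W t z\<close> and
    \<open>\<alpha>w (- H1 t z) * W t z\<close>.\<close>
  have H1_rate: "\<exists>w. \<bar>w\<bar> \<le> W t z \<and> time_deriv D H1 t z +
        grad H1 t z \<bullet> sys_field f g t z (u t z) (wu t) (wx t) = (\<alpha>w (- H1 t z) - 1) * W t z + w"
    if "t0 \<le> t" "H1 t z \<le> 0" "h t z \<le> d" for t z
    using disturbance[OF that(1)] u_eq[of t z] that
    by (intro exI[of _ "grad H1 t z \<bullet> (g t z *v wu t) + grad H1 t z \<bullet> wx t"])
       (simp add: D S1_set_def sys_field_def algebra_simps)
  have W_pos: "0 < W t z" if "t0 \<le> t" "H1 t z \<le> 0" for t z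
    using W_bounds[of t z] that \<eta>(1) by (force simp: D)

  \<comment> \<open>Behaviour along the trajectory\<close>
  define k where "k t = h t (x t)" for t
  define q where "q t = hdot D f g h t (x t) (wx t)" for t
  note along_x = continuous_on_along_curve[OF _ x_cont[unfolded D] order_refl]
  have k_cont: "continuous_on {t0..} k"
    unfolding k_def by (rule along_x[OF C1_on_imp_continuous_on[OF h_C1]])
  have H1_cont: "continuous_on {t0..} (\<lambda>t. H1 t (x t))"
    by (rule along_x[OF C1_on_imp_continuous_on[OF H1_C1]])
  \<comment> \<open>\<open>q\<close> is continuous although \<open>u\<close> may jump, since
    \<open>hdot\<close> contains no input; this allows a first time with \<open>q \<le> 0\<close> to
    be taken below.\<close>
  have q_cont: "continuous_on {t0..} q"
  proof -
    have "continuous_on {t0..} (\<lambda>t. time_deriv {t0..} h t (x t))"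
      using h_C1 by (intro along_x) (simp add: C1_on_def)
    moreover have "continuous_on {t0..} (\<lambda>t. grad h t (x t))"
      using h_C1 by (intro along_x) (simp add: C1_on_def)
    moreover have "continuous_on {t0..} (\<lambda>t. f t (x t))"
      by (rule along_x[OF locally_lipschitz_on_imp_continuous_on[OF f[unfolded D]]])
    ultimately show ?thesis
      using wx(1) unfolding q_def hdot_def total_deriv_def sys_field_def D
      by (auto intro!: continuous_intros)
  qed
  have interior: "at t within {t0..} = at t" if "t0 < t" for t
    using that by (intro at_within_interior) simp
  have k_deriv: "(k has_real_derivative q t) (at t)" if "t0 < t" "t \<notin> J" for t
    using C1_on_along_curve[OF h_C1 _ order_refl, of t x] x_deriv[of t] that total_h[of t] interior[of t]
    unfolding k_def q_def by (fastforce simp: D total_deriv_def)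
  have H1_deriv: "((\<lambda>t. H1 t (x t)) has_real_derivative time_deriv D H1 t (x t) +
      grad H1 t (x t) \<bullet> sys_field f g t (x t) (u t (x t)) (wu t) (wx t)) (at t)" if "t0 < t" "t \<notin> J" for t
    using C1_on_along_curve[OF H1_C1 _ order_refl, of t x] x_deriv[of t] that interior[of t]
    by (simp add: D)

  \<comment> \<open>Stated for any interval on which contact has not been passed: it serves once to
    rule out that \<open>k\<close> stays nonpositive forever, and once on
    \<open>{t0..tf}\<close>.\<close>
  have approach: "H1 t (x t) \<le> 0 \<and> \<gamma>1 \<le> q t \<and> k t0 + \<gamma>1 * (t - t0) \<le> k t"
    if b: "\<And>t. t \<in> {t0..b} \<Longrightarrow> k t \<le> 0" and t: "t \<in> {t0..b}" for b t
  proof -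
    obtain B where B: "\<And>v. v \<in> U \<Longrightarrow> norm v \<le> B"
      using compact_imp_bounded[OF U(1)] by (auto simp: bounded_iff)
    have u_bound: "norm (u t z + wu t) \<le> B + wu_max" if "t0 \<le> t" for t z
      using B[OF u_range] wu(2)[of t] that by (intro norm_triangle_le add_mono) (auto simp: D)
    have boundary: "time_deriv {t0..} H1 t z + grad H1 t z \<bullet> sys_field f g t z (u t z) (wu t) (wx t) \<le> 0"
      if "t0 \<le> t" "H1 t z = 0" "h t z \<le> d" for t z
      using H1_rate[of t z] that \<alpha>w(1) by (auto simp: class_K_def D)
    \<comment> \<open>A vanishing gradient would make both summands of \<open>W\<close>
      zero.\<close>
    have grad_H1: "grad H1 t z \<noteq> 0" if "t0 \<le> t" "H1 t z \<le> 0" for t z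
      using W_pos[OF that] by (auto simp: W W_fun_def)
    have h_less: "h t (x t) < d" if "t \<in> {t0..b}" for t
      using b[OF that] d_pos by (simp add: k_def)
    have "H1 t0 (x t0) \<le> 0" using x0(1) by (simp add: S1_set_def)
    from sublevel_invariance[OF f[unfolded D] g[unfolded D] u_state[unfolded D] u_bound H1_C1
        C1_on_imp_continuous_on[OF h_C1] x[unfolded D] grad_H1 boundary this h_less]
    have H1_le: "H1 t (x t) \<le> 0" if "t \<in> {t0..b}" for t
      using that by blast
    have H1_ge: "- \<epsilon> \<le> H1 t (x t)" if "t \<in> {t0..b}" for t
    proof (rule stays_above_level[where y = "\<lambda>t. H1 t (x t)" and a = t0 and b = b])
      show "finite (J \<inter> {t0..b})" by (rule J)
      show "continuous_on {t0..b} (\<lambda>t. H1 t (x t))" by (rule continuous_on_subset[OF H1_cont]) auto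
      show "- \<epsilon> \<le> H1 t0 (x t0)" using x0(2) by (simp add: S1_shell_def)
      fix s assume s: "s \<in> {t0<..<b} - J \<inter> {t0..b}" "H1 s (x s) < - \<epsilon>"
      have "h s (x s) \<le> d" using b[of s] s(1) d_pos by (simp add: k_def)
      then obtain w where w: "\<bar>w\<bar> \<le> W s (x s)" "time_deriv D H1 s (x s) +
          grad H1 s (x s) \<bullet> sys_field f g s (x s) (u s (x s)) (wu s) (wx s) = (\<alpha>w (- H1 s (x s)) - 1) * W s (x s) + w"
        using H1_rate[of s "x s"] H1_le[of s] s(1) by auto
      \<comment> \<open>Below the shell \<open>\<alpha>w\<close> exceeds 2, so the rate is at least
        \<open>W s (x s) + w\<close>, which is nonnegative.\<close>
      have "\<alpha>w \<epsilon> < \<alpha>w (- H1 s (x s))"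
        using \<alpha>w(1) s(2) \<epsilon>_pos by (auto simp: class_K_def strict_mono_on_def)
      then have "1 * W s (x s) \<le> (\<alpha>w (- H1 s (x s)) - 1) * W s (x s)"
        using W_pos[of s "x s"] H1_le[of s] s(1) \<alpha>w_\<epsilon> by (intro mult_right_mono) auto
      with w have "0 \<le> time_deriv D H1 s (x s) +
          grad H1 s (x s) \<bullet> sys_field f g s (x s) (u s (x s)) (wu s) (wx s)" by linarith
      then show "\<exists>y'\<ge>0. ((\<lambda>t. H1 t (x t)) has_real_derivative y') (at s)"
        using H1_deriv[of s] s(1) by auto
    qed (rule that)
    \<comment> \<open>\<open>approach_in_Y\<close> covers only states whose \<open>h\<close> is at
      least its initial value, hence the condition \<open>k t0 \<le> k t\<close>. In
      \<open>Y\<close> the gradient of \<open>h\<close> is bounded by \<open>l_h\<close>, and the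
      margin in \<open>lower\<close> absorbs the disturbance.\<close>
    have q_ge: "\<gamma>1 \<le> q t" if "t \<in> {t0..b}" "k t0 \<le> k t" for t
    proof -
      have "x t \<in> Y"
        using approach_in_Y[of t] H1_le[of t] H1_ge[of t] b[of t] that d_pos
        by (auto simp: D S1_shell_def S1_set_def k_def)
      then have "grad h t (x t) \<bullet> v \<le> l_h * norm v" for v
        using that(1) l_h[of t] by (intro grad_le_lipschitz[OF h_C1 _ Y_nbhd(1)]) (auto simp: D)
      then have "hdot_w D f g wx_max h t (x t) \<le> q t + 2 * l_h * wx_max"
        unfolding q_def using wx(2)[of t] that(1) l_nonneg by (intro hdot_w_le_hdot) (auto simp: D)
      with lower[of t "x t"] H1_ge[of t] b[of t] that(1) show ?thesis by (auto simp: k_def)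
    qed
    have k_incr: "c * (t - t0) \<le> k t - k t0"
      if "t \<in> {t0..b}" "\<And>s. s \<in> {t0<..<t} \<Longrightarrow> c \<le> q s" for c t
    proof (rule increment_ge_of_deriv_ge)
      show "finite (J \<inter> {t0..t})" by (rule J)
      show "continuous_on {t0..t} k" by (rule continuous_on_subset[OF k_cont]) auto
      show "\<exists>y'\<ge>c. (k has_real_derivative y') (at s)" if "s \<in> {t0<..<t} - J \<inter> {t0..t}" for s
        using k_deriv[of s] \<open>\<And>s. s \<in> {t0<..<t} \<Longrightarrow> c \<le> q s\<close>[of s] that by auto
    qed (use that in auto)
    \<comment> \<open>\<open>q_ge\<close> needs \<open>k t0 \<le> k t\<close>, which holds up to the first time with \<open>q \<le> 0\<close>; but at that
      time \<open>q_ge\<close> gives \<open>\<gamma>1 \<le> q\<close>, so there is none.\<close>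
    have q_pos: "0 < q t" if "t \<in> {t0..b}" for t
    proof (rule ccontr)
      assume neg: "\<not> 0 < q t"
      define Q where "Q = {s \<in> {t0..b}. q s \<le> 0}"
      have "continuous_on {t0..b} q" by (rule continuous_on_subset[OF q_cont]) auto
      then have "closed Q"
        unfolding Q_def by (rule continuous_on_closed_Collect_le[OF _ continuous_on_const]) simp
      moreover have bdd: "bdd_below Q" by (rule bdd_belowI[of _ t0]) (simp add: Q_def)
      moreover have "t \<in> Q" using neg that by (simp add: Q_def)
      ultimately have "Inf Q \<in> Q" by (intro closed_contains_Inf) auto
      moreover have "0 \<le> q s" if "s \<in> {t0<..<Inf Q}" for s
      proof (rule ccontr)
        assume "\<not> 0 \<le> q s"
        with that \<open>Inf Q \<in> Q\<close> have "s \<in> Q" by (auto simp: Q_def)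
        from cInf_lower[OF this bdd] that show False by simp
      qed
      ultimately have "\<gamma>1 \<le> q (Inf Q)" using k_incr[of "Inf Q" 0] by (intro q_ge) (auto simp: Q_def)
      with \<open>Inf Q \<in> Q\<close> \<gamma>(2) show False by (simp add: Q_def)
    qed
    have "k t0 \<le> k s" if "s \<in> {t0..b}" for s
      using k_incr[of s 0] q_pos that by (force intro: less_imp_le)
    then have "\<gamma>1 \<le> q s" if "s \<in> {t0..b}" for s using q_ge that by blast
    then show ?thesis using H1_le[OF t] k_incr[of t \<gamma>1] t by force
  qed

  \<comment> \<open>The time of contact\<close>
  have "\<exists>t\<ge>t0. k t > 0"
  proof (rule ccontr)
    assume *: "\<not> ?thesis"
    \<comment> \<open>Growth at rate \<gamma>1 from \<open>k t0\<close> reaches exactly 1 at this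
      time.\<close>
    define b where "b = t0 + (1 - k t0) / \<gamma>1"
    have "k t0 \<le> 0" using not_penetrating by (simp add: k_def)
    then have "t0 \<le> b" using \<gamma> by (simp add: b_def)
    moreover have "k t \<le> 0" if "t0 \<le> t" for t using * that by force
    ultimately have "k t0 + \<gamma>1 * (b - t0) \<le> k b" using approach[of b b] by auto
    then have "1 \<le> k b" using \<gamma> by (simp add: b_def)
    with \<open>\<And>t. t0 \<le> t \<Longrightarrow> k t \<le> 0\<close>[OF \<open>t0 \<le> b\<close>] show False by simp
  qed
  then obtain t1 where t1: "t0 \<le> t1" "k t1 > 0" by blast
  define Z where "Z = {t \<in> {t0..t1}. 0 \<le> k t}"
  define tf where "tf = Inf Z"
  have "continuous_on {t0..t1} k" by (rule continuous_on_subset[OF k_cont]) auto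
  then have "closed Z"
    unfolding Z_def by (rule continuous_on_closed_Collect_le[OF continuous_on_const]) simp
  moreover have bdd: "bdd_below Z" by (rule bdd_belowI[of _ t0]) (simp add: Z_def)
  moreover have "t1 \<in> Z" using t1 by (simp add: Z_def)
  ultimately have tf: "tf \<in> Z" unfolding tf_def by (intro closed_contains_Inf) auto
  have before: "k t < 0" if "t0 \<le> t" "t < tf" for t
  proof (rule ccontr)
    assume "\<not> k t < 0"
    with that tf have "t \<in> Z" by (auto simp: Z_def)
    from cInf_lower[OF this bdd] that show False by (simp add: tf_def)
  qed
  \<comment> \<open>Either contact holds at the start, or the intermediate value theorem gives a
    zero up to \<open>tf\<close>; it must be \<open>tf\<close>, as \<open>k\<close> is negative
    earlier.\<close>
  have "k tf = 0"
  proof (cases "tf = t0")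
    case True
    then show ?thesis using tf not_penetrating by (auto simp: Z_def k_def)
  next
    case False
    with tf have "t0 < tf" by (auto simp: Z_def)
    have "\<exists>s\<ge>t0. s \<le> tf \<and> k s = 0"
      using tf not_penetrating
      by (intro IVT') (auto simp: Z_def k_def intro: continuous_on_subset[OF k_cont[unfolded k_def[abs_def]]])
    then show ?thesis using before by (metis less_le_not_le less_irrefl order_le_less)
  qed
  have "k t \<le> 0" if "t \<in> {t0..tf}" for t
    using before[of t] that \<open>k tf = 0\<close> by (cases "t = tf") auto
  then have *: "H1 tf (x tf) \<le> 0" "\<gamma>1 \<le> q tf" using approach[of tf tf] tf by (auto simp: Z_def)
  have "t0 \<le> tf" using tf by (simp add: Z_def)
  have "q tf \<le> hdot_w D f g wx_max h tf (x tf)"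
    unfolding q_def using wx(2)[of tf] \<open>t0 \<le> tf\<close> by (intro hdot_le_hdot_w) (simp add: D)
  also have "\<dots> \<le> \<gamma>2" using upper *(1) \<open>k tf = 0\<close> by (simp add: k_def)
  finally have "q tf \<in> {\<gamma>1..\<gamma>2}" using *(2) by simp
  then show ?thesis
    using \<open>t0 \<le> tf\<close> \<open>k tf = 0\<close> total_h[OF \<open>t0 \<le> tf\<close>] by (auto simp: k_def q_def)
qed

end
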